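(* Let $\Omega\subset\mathbb{R}^n$, $n\ge 3$, be a bounded domain with smooth boundary and let $0<\lambda_1\le\lambda_2\le\cdots$, $\lambda_k\to\infty$, be the Dirichlet eigenvalues of $-\Delta$ on $\Omega$. Fix real numbers $b>\tau>0$ and $\alpha\ne 0$, and for $k\ge1$ let $$P_k(s)=(s^2+\lambda_k)\bigl(\tau s^3+s^2+b\lambda_k s+\lambda_k\bigr)-\alpha^2(1+\tau s),\qquad s\in\mathbb{C}.$$ For each sign $\sigma\in\{+1,-1\}$ there exists, for all sufficiently large $k$, a root $s_{k,\sigma}$ of $P_k$ such that $$s_{k,\sigma}=\sigma i\sqrt{\lambda_k}-\frac{\alpha^2}{2(b-\tau)\lambda_k^2}-\sigma i\,\frac{\alpha^2\tau}{2(b-\tau)\lambda_k^{3/2}}+O(\lambda_k^{-5/2})\qquad\text{as }k\to\infty .$$ In particular, $$\Re s_{k,\sigma}=-\frac{\alpha^2}{2(b-\tau)\lambda_k^2}+O(\lambda_k^{-5/2})\longrightarrow 0^- ;$$ equivalently, with $c_w=1$ and $c_{\mathrm{mgt}}=\sqrt{b/\tau}$, $$\Re s_{k,\sigma}=-\frac{\alpha^2}{2\tau(c_{\mathrm{mgt}}^2-c_w^2)\lambda_k^2}+O(\lambda_k^{-5/2}).$$ Thus the real part of the wave-branch roots $s_{k,\sigma}$ is only of order $\lambda_k^{-2}$ at high frequency, and the linearized spectrum (the set of roots of the polynomials $P_k$, $k\ge1$) has no uniform gap from the imaginary axis: there is no $\delta>0$ such that all roots $s$ of all $P_k$ satisfy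 $|\Re s|\ge\delta$.
   Context: The roots of $P_k$ are exactly the modal characteristic roots of the linear system $$u_{tt}-\Delta u+\alpha(v+\tau v_t)=0,\qquad \tau v_{ttt}+v_{tt}-\Delta v-b\Delta v_t+\alpha u=0$$ with homogeneous Dirichlet conditions: they are the $s\in\mathbb{C}$ for which there is a nontrivial solution $u=a_ke^{st}e_k(x)$, $v=c_ke^{st}e_k(x)$, where $-\Delta e_k=\lambda_ke_k$, $e_k|_{\partial\Omega}=0$ and $\{e_k\}$ is a Dirichlet eigenbasis. Eigenvalues are listed with multiplicity. *)

theory Defs
  imports "HOL-Analysis.Analysis" "HOL-Library.Landau_Symbols"
begin

definition partial_deriv :: "'n \<Rightarrow> (real^'n \<Rightarrow> real) \<Rightarrow> real^'n \<Rightarrow> real" where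
  "partial_deriv i f x = frechet_derivative f (at x) (axis i 1)"

definition laplacian :: "(real^'n \<Rightarrow> real) \<Rightarrow> real^'n \<Rightarrow> real" where
  "laplacian f x = (\<Sum>i\<in>UNIV. partial_deriv i (partial_deriv i f) x)"

text \<open>\<open>C_k_on m S f\<close>: \<open>f\<close> is of class $C^m$ on \<open>S\<close>. Meant for open \<open>S\<close> only, since the
  derivatives are taken in full neighbourhoods of the points of \<open>S\<close>.\<close>

primrec C_k_on :: "nat \<Rightarrow> (real^'n) set \<Rightarrow> (real^'n \<Rightarrow> real) \<Rightarrow> bool" where
  "C_k_on 0 S f \<longleftrightarrow> continuous_on S f"
| "C_k_on (Suc m) S f \<longleftrightarrow>
     (\<forall>x\<in>S. f differentiable (at x)) \<and> (\<forall>i. C_k_on m S (partial_deriv i f))"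

text \<open>Near every boundary point, after a rigid motion, \<open>\<Omega>\<close> is the region strictly above the graph
  of a $C^\infty$ function of $n-1$ variables. The unit vector \<open>\<nu>\<close> is the direction of the
  graph; \<open>x - (x \<bullet> \<nu>) *\<^sub>R \<nu>\<close> is the projection of \<open>x\<close> to the hyperplane orthogonal to \<open>\<nu>\<close>, and
  only the values of \<open>\<gamma>\<close> on that hyperplane matter.\<close>

definition smooth_boundary :: "(real^'n) set \<Rightarrow> bool" where
  "smooth_boundary \<Omega> \<longleftrightarrow>
     (\<forall>p\<in>frontier \<Omega>. \<exists>r>0. \<exists>\<nu> \<gamma>. norm \<nu> = 1 \<and> (\<forall>m. C_k_on m UNIV \<gamma>) \<and>
        \<Omega> \<inter> ball p r = {x \<in> ball p r. x \<bullet> \<nu> > \<gamma> (x - (x \<bullet> \<nu>) *\<^sub>R \<nu>)})"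

definition smooth_bounded_domain :: "(real^'n) set \<Rightarrow> bool" where
  "smooth_bounded_domain \<Omega> \<longleftrightarrow>
     open \<Omega> \<and> connected \<Omega> \<and> \<Omega> \<noteq> {} \<and> bounded \<Omega> \<and> smooth_boundary \<Omega>"

definition L2_on :: "(real^'n) set \<Rightarrow> (real^'n \<Rightarrow> real) set" where
  "L2_on \<Omega> = {f \<in> borel_measurable (lebesgue_on \<Omega>). integrable (lebesgue_on \<Omega>) (\<lambda>x. (f x)\<^sup>2)}"

definition L2_inner :: "(real^'n) set \<Rightarrow> (real^'n \<Rightarrow> real) \<Rightarrow> (real^'n \<Rightarrow> real) \<Rightarrow> real" where
  "L2_inner \<Omega> f g = (\<integral>x. f x * g x \<partial>lebesgue_on \<Omega>)"

definition dirichlet_eigenfunction :: "(real^'n) set \<Rightarrow> real \<Rightarrow> (real^'n \<Rightarrow> real) \<Rightarrow> bool" where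
  "dirichlet_eigenfunction \<Omega> \<mu> e \<longleftrightarrow>
     C_k_on 2 \<Omega> e \<and> continuous_on (closure \<Omega>) e \<and> (\<exists>x\<in>\<Omega>. e x \<noteq> 0) \<and>
     (\<forall>x\<in>\<Omega>. - laplacian e x = \<mu> * e x) \<and> (\<forall>x\<in>frontier \<Omega>. e x = 0)"

text \<open>\<open>(e k)\<close>, $k \ge 1$, is an orthonormal (Hilbert) basis of $L^2(\Omega)$ consisting of
  Dirichlet eigenfunctions, \<open>lam k\<close> being the eigenvalue of \<open>e k\<close>. Hence \<open>lam\<close> lists all the
  Dirichlet eigenvalues, each one repeated according to its multiplicity. Index 0 is not used.\<close>

definition dirichlet_eigenbasis ::
    "(real^'n) set \<Rightarrow> (nat \<Rightarrow> real) \<Rightarrow> (nat \<Rightarrow> real^'n \<Rightarrow> real) \<Rightarrow> bool" where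
  "dirichlet_eigenbasis \<Omega> lam e \<longleftrightarrow>
     (\<forall>k\<ge>1. dirichlet_eigenfunction \<Omega> (lam k) (e k)) \<and>
     (\<forall>j\<ge>1. \<forall>k\<ge>1. L2_inner \<Omega> (e j) (e k) = (if j = k then 1 else 0)) \<and>
     (\<forall>f\<in>L2_on \<Omega>.
        (\<lambda>N. \<integral>x. (f x - (\<Sum>k=1..N. L2_inner \<Omega> f (e k) * e k x))\<^sup>2 \<partial>lebesgue_on \<Omega>)
          \<longlonglongrightarrow> 0)"

definition char_P :: "real \<Rightarrow> real \<Rightarrow> real \<Rightarrow> real \<Rightarrow> complex \<Rightarrow> complex" where
  "char_P \<tau> b \<alpha> \<mu> s =
     (s^2 + of_real \<mu>) *
       (of_real \<tau> * s^3 + s^2 + of_real b * of_real \<mu> * s + of_real \<mu>)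
     - (of_real \<alpha>)^2 * (1 + of_real \<tau> * s)"

definition linearized_spectrum :: "real \<Rightarrow> real \<Rightarrow> real \<Rightarrow> (nat \<Rightarrow> real) \<Rightarrow> complex set" where
  "linearized_spectrum \<tau> b \<alpha> lam = {s. \<exists>k\<ge>1. char_P \<tau> b \<alpha> (lam k) s = 0}"

end

theory Submission
  imports Defs "HOL-Real_Asymp.Real_Asymp"
begin

text \<open>Write \<open>\<mu> = \<omega>\<^sup>2\<close>, \<open>w = \<plusminus>\<i>\<omega>\<close> and \<open>s = w + z\<close>. Since \<open>s\<^sup>2 + \<mu> = z (2 w + z)\<close>, the equation
  \<open>P(s) = 0\<close> is the fixed point equation \<open>z = \<alpha>\<^sup>2 (1 + \<tau> s) / D(z)\<close>, where \<open>D(z)\<close> is \<open>2 w + z\<close> times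
  the cubic factor of \<open>P\<close>. As \<open>D(0) = -2 (b - \<tau>) \<omega>\<^sup>4\<close> and \<open>D(z) - D(0) = O(\<omega>\<^sup>3 z)\<close>, for large \<open>\<omega>\<close>
  the right-hand side maps the unit disc into itself, so Brouwer gives a fixed point; it differs from
  the value \<open>\<alpha>\<^sup>2 (1 + \<tau> w) / D(0)\<close> at \<open>z = 0\<close>, which is the claimed expansion, by a relative error
  \<open>O(\<omega>\<^sup>-\<^sup>4)\<close>.\<close>

section \<open>The factored characteristic equation and bounds on its denominator\<close>

definition wave_denom :: "real \<Rightarrow> real \<Rightarrow> real \<Rightarrow> complex \<Rightarrow> complex \<Rightarrow> complex" where
  "wave_denom \<tau> b \<omega> w z = (2 * w + z) *
     (of_real \<tau> * (w + z)^3 + (w + z)^2 + of_real b * of_real (\<omega>\<^sup>2) * (w + z) + of_real (\<omega>\<^sup>2))"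

lemma char_P_wave_denom:
  assumes "w\<^sup>2 = - of_real (\<omega>\<^sup>2)"
  shows "char_P \<tau> b \<alpha> (\<omega>\<^sup>2) (w + z) =
    z * wave_denom \<tau> b \<omega> w z - (of_real \<alpha>)\<^sup>2 * (1 + of_real \<tau> * (w + z))"
proof -
  have "(w + z)\<^sup>2 + of_real (\<omega>\<^sup>2) = z * (2 * w + z)"
    using assms by (simp add: power2_eq_square algebra_simps)
  then show ?thesis
    unfolding char_P_def wave_denom_def by (simp only: mult.assoc)
qed

text \<open>At \<open>s = w\<close> the terms \<open>s^2 + \<mu>\<close> of the cubic factor cancel,
  and \<open>\<tau> * s^3 + b * \<mu> * s\<close> collapses to
  \<open>(b - \<tau>) * \<mu> * w\<close>. The gap between \<open>b\<close> and
  \<open>\<tau>\<close> is thus what will keep the denominator away from zero.\<close>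

lemma wave_denom_0:
  assumes "w\<^sup>2 = - of_real (\<omega>\<^sup>2)"
  shows "wave_denom \<tau> b \<omega> w 0 = - of_real (2 * (b - \<tau>) * \<omega>^4)"
proof -
  have "w^3 = - of_real (\<omega>\<^sup>2) * w"
    using assms by (simp add: power3_eq_cube power2_eq_square)
  then have "wave_denom \<tau> b \<omega> w 0 = 2 * of_real (b - \<tau>) * of_real (\<omega>\<^sup>2) * w\<^sup>2"
    using assms unfolding wave_denom_def of_real_diff by algebra
  then show ?thesis
    unfolding assms by (simp add: power4_eq_xxxx power2_eq_square mult.assoc)
qed

text \<open>The change has order \<omega>^3 against \<omega>^4 for the value at 0. This serves
  twice: it keeps the denominator nonzero on the closed unit disc, and it measures how far the fixed
  point map moves from its value at 0.\<close>

lemma wave_denom_diff: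
  assumes "0 < \<tau>" "\<tau> < b" "1 \<le> \<omega>" "cmod z \<le> 1" and w: "w\<^sup>2 = - of_real (\<omega>\<^sup>2)" "cmod w = \<omega>"
  shows "cmod (wave_denom \<tau> b \<omega> w z - wave_denom \<tau> b \<omega> w 0) \<le> (21 * \<tau> + 4 * b + 9) * \<omega>^3 * cmod z"
proof -
  \<comment> \<open>\<open>R\<close> is the difference quotient of the cubic factor: with Q denoting
    that factor, Q(w + z) - Q(w) = z R.\<close>
  define R where "R = of_real \<tau> * (3 * w\<^sup>2 + 3 * w * z + z\<^sup>2) + 2 * w + z + of_real (b * \<omega>\<^sup>2)"
  \<comment> \<open>\<open>K * \<omega>^2\<close> bounds \<open>R\<close>: 7 = 3 + 3 + 1 from the
    divided cube, 3 = 2 + 1 from \<open>2 * w + z\<close>, and \<open>b\<close> from the linear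
    term. The final constant is \<open>b + 3 * K\<close>.\<close>
  define K where "K = 7 * \<tau> + b + 3"
  have pow: "1 \<le> \<omega>\<^sup>2" "\<omega> \<le> \<omega>\<^sup>2" "\<omega>\<^sup>2 \<le> \<omega>^3"
    using \<open>1 \<le> \<omega>\<close> by (auto intro: self_le_power power_increasing one_le_power)
  have w3: "w^3 = - of_real (\<omega>\<^sup>2) * w"
    using w by (simp add: power3_eq_cube power2_eq_square)
  \<comment> \<open>Expand (2w + z)(Q(w) + z R) - 2w Q(w), where Q(w) = (b - \<tau>) \<omega>^2
    w.\<close>
  have diff: "wave_denom \<tau> b \<omega> w z - wave_denom \<tau> b \<omega> w 0
      = z * (of_real ((b - \<tau>) * \<omega>\<^sup>2) * w + z * R + 2 * w * R)"
    using w3 w(1) unfolding wave_denom_def R_def of_real_diff of_real_mult by algebra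
  have "\<omega> * cmod z \<le> \<omega>" "(cmod z)\<^sup>2 \<le> 1"
    using assms by (auto intro: mult_left_le power_le_one)
  then have wz: "cmod (w * z) \<le> \<omega>\<^sup>2" "cmod (z\<^sup>2) \<le> \<omega>\<^sup>2"
    using w(2) pow by (auto simp: norm_mult norm_power)
  have "cmod (3 * w\<^sup>2 + 3 * w * z + z\<^sup>2) \<le> 3 * cmod (w\<^sup>2) + 3 * cmod (w * z) + cmod (z\<^sup>2)"
    by (rule norm_triangle_le, rule add_mono, rule norm_triangle_le) (auto simp: norm_mult)
  also have "\<dots> \<le> 7 * \<omega>\<^sup>2"
    using wz w by (simp add: norm_power)
  finally have "cmod (of_real \<tau> * (3 * w\<^sup>2 + 3 * w * z + z\<^sup>2)) \<le> \<tau> * (7 * \<omega>\<^sup>2)"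
    using \<open>0 < \<tau>\<close> by (simp add: norm_mult)
  moreover have "cmod (2 * w) \<le> 2 * \<omega>\<^sup>2" "cmod z \<le> \<omega>\<^sup>2" "cmod (of_real (b * \<omega>\<^sup>2)) \<le> b * \<omega>\<^sup>2"
    using assms pow by (auto simp: norm_mult norm_power)
  ultimately have "cmod R \<le> \<tau> * (7 * \<omega>\<^sup>2) + 2 * \<omega>\<^sup>2 + \<omega>\<^sup>2 + b * \<omega>\<^sup>2"
    unfolding R_def by (intro norm_triangle_mono)
  then have R: "cmod R \<le> K * \<omega>\<^sup>2"
    by (simp add: K_def algebra_simps)
  have K: "0 < K"
    using assms by (simp add: K_def)
  have "cmod (of_real ((b - \<tau>) * \<omega>\<^sup>2) * w) \<le> b * \<omega>^3"
    using assms by (simp add: norm_mult norm_power power2_eq_square power3_eq_cube mult_right_mono flip: of_real_diff)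
  moreover have "cmod (z * R) \<le> K * \<omega>^3"
  proof -
    have "cmod (z * R) \<le> 1 * (K * \<omega>\<^sup>2)"
      unfolding norm_mult using assms R by (intro mult_mono) auto
    also have "\<dots> \<le> K * \<omega>^3"
      using K pow by simp
    finally show ?thesis .
  qed
  moreover have "cmod (2 * w * R) \<le> 2 * K * \<omega>^3"
    using mult_left_mono[OF R, of "2 * \<omega>"] assms
    by (simp add: norm_mult power2_eq_square power3_eq_cube mult_ac)
  ultimately have "cmod (of_real ((b - \<tau>) * \<omega>\<^sup>2) * w + z * R + 2 * w * R)
      \<le> b * \<omega>^3 + K * \<omega>^3 + 2 * K * \<omega>^3"
    by (intro norm_triangle_mono)
  also have "\<dots> = (21 * \<tau> + 4 * b + 9) * \<omega>^3"
    by (simp add: K_def algebra_simps)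
  finally show ?thesis
    unfolding diff norm_mult[of z] by (subst mult.commute) (rule mult_right_mono, simp_all)
qed

section \<open>A root near each large wave frequency, by Brouwer's theorem\<close>

text \<open>\<open>N\<close> and \<open>\<omega>0\<close> are chosen before \<open>\<omega>\<close>
  and \<open>w\<close>, so one pair of constants serves every large eigenvalue and both signs of
  \<open>w\<close>.\<close>

lemma wave_root_near:
  assumes "0 < \<tau>" "\<tau> < b"
  obtains N \<omega>0 :: real where "0 < \<omega>0"
    and "\<And>\<omega> w. \<omega>0 \<le> \<omega> \<Longrightarrow> w\<^sup>2 = - of_real (\<omega>\<^sup>2) \<Longrightarrow> cmod w = \<omega> \<Longrightarrow>
      \<exists>s. char_P \<tau> b \<alpha> (\<omega>\<^sup>2) s = 0 \<and>
        cmod (s - (w - of_real (\<alpha>\<^sup>2) * (1 + of_real \<tau> * w) / of_real (2 * (b - \<tau>) * \<omega>^4))) \<le> N / \<omega>^5"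
proof -
  define \<beta> where "\<beta> = b - \<tau>"
  define L where "L = 21 * \<tau> + 4 * b + 9"
  \<comment> \<open>\<open>M / \<omega>^3\<close> will bound the fixed point map on the unit disc:
    its numerator is at most \<alpha>^2 (1 + 2\<tau>) \<omega>, its denominator at least \<beta>
    \<omega>^4.\<close>
  define M where "M = \<alpha>\<^sup>2 * (1 + 2 * \<tau>) / \<beta>"
  \<comment> \<open>The two summands come from the variation of the numerator and of the denominator
    when the fixed point \<open>z\<close> is replaced by 0.\<close>
  define N where "N = \<alpha>\<^sup>2 * M * (\<tau> / \<beta> + (1 + \<tau>) * L / (2 * \<beta>\<^sup>2))"
  have pos: "0 < \<beta>" "0 < L" "0 \<le> M"
    using assms by (auto simp: \<beta>_def L_def M_def)
  have "0 \<le> N"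
    unfolding N_def using pos assms by (intro mult_nonneg_nonneg add_nonneg_nonneg) auto
  have root: "\<exists>s. char_P \<tau> b \<alpha> (\<omega>\<^sup>2) s = 0 \<and>
        cmod (s - (w - of_real (\<alpha>\<^sup>2) * (1 + of_real \<tau> * w) / of_real (2 * \<beta> * \<omega>^4))) \<le> N / \<omega>^5"
    if \<omega>: "max 1 (max M (L / \<beta>)) \<le> \<omega>" and w: "w\<^sup>2 = - of_real (\<omega>\<^sup>2)" "cmod w = \<omega>" for \<omega> :: real and w
  proof -
    \<comment> \<open>The three entries of the threshold: 1 lets powers of \<open>\<omega>\<close>
      be compared, \<open>M\<close> makes the map send the unit disc into itself, and
      \<open>L / \<beta>\<close> limits the variation of the denominator to half of its modulus at
      0.\<close>
    have \<omega>1: "1 \<le> \<omega>" and \<omega>M: "M \<le> \<omega>" and \<omega>L: "L \<le> \<beta> * \<omega>"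
      using \<omega> pos by (auto simp: divide_simps mult.commute)
    define D where "D = wave_denom \<tau> b \<omega> w"
    define F where "F z = of_real (\<alpha>\<^sup>2) * (1 + of_real \<tau> * (w + z)) / D z" for z
    have D0: "D 0 = - of_real (2 * \<beta> * \<omega>^4)"
      using wave_denom_0[OF w(1)] by (simp add: D_def \<beta>_def)
    have D_diff: "cmod (D z - D 0) \<le> L * \<omega>^3 * cmod z" if "cmod z \<le> 1" for z
      using wave_denom_diff[OF assms \<omega>1 that w] by (simp add: D_def L_def)
    have D_ge: "\<beta> * \<omega>^4 \<le> cmod (D z)" if "cmod z \<le> 1" for z
    proof -
      have "cmod (D z - D 0) \<le> L * \<omega>^3 * 1"
        using D_diff[OF that] mult_left_mono[OF that, of "L * \<omega>^3"] pos \<omega>1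
        by (meson less_eq_real_def mult_nonneg_nonneg order_trans zero_le_one zero_le_power)
      also have "\<dots> \<le> \<beta> * \<omega>^4"
        using mult_right_mono[OF \<omega>L, of "\<omega>^3"] \<omega>1 by (simp add: eval_nat_numeral mult_ac)
      finally have "cmod (D z - D 0) \<le> \<beta> * \<omega>^4" .
      moreover have "cmod (D 0) = 2 * \<beta> * \<omega>^4"
        using pos \<omega>1 unfolding D0 by (simp add: norm_mult norm_power)
      moreover have "cmod (D 0) \<le> cmod (D z) + cmod (D z - D 0)"
        by (metis norm_minus_commute norm_triangle_sub)
      ultimately show ?thesis by linarith
    qed
    have \<beta>\<omega>: "0 < \<beta> * \<omega>^4"
      using pos \<omega>1 by simp
    have D_nz: "D z \<noteq> 0" if "cmod z \<le> 1" for z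
      using D_ge[OF that] \<beta>\<omega> by auto
    have F_le: "cmod (F z) \<le> M / \<omega>^3" if "cmod z \<le> 1" for z
    proof -
      have "cmod (1 + of_real \<tau> * (w + z)) \<le> 1 + \<tau> * (\<omega> + 1)"
      proof (rule norm_triangle_le, rule add_mono)
        have "cmod (w + z) \<le> \<omega> + 1"
          using that w by (intro norm_triangle_le) simp
        then show "cmod (of_real \<tau> * (w + z)) \<le> \<tau> * (\<omega> + 1)"
          using assms by (simp add: norm_mult)
      qed simp
      also have "\<dots> \<le> (1 + 2 * \<tau>) * \<omega>"
      proof -
        \<comment> \<open>This product is exactly the right side minus the left side of the desired
          inequality.\<close>
        have "0 \<le> (1 + \<tau>) * (\<omega> - 1)"
          using \<omega>1 assms by (intro mult_nonneg_nonneg) auto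
        then show ?thesis
          unfolding ring_distribs by linarith
      qed
      finally have "cmod (F z) \<le> \<alpha>\<^sup>2 * ((1 + 2 * \<tau>) * \<omega>) / (\<beta> * \<omega>^4)"
        unfolding F_def norm_divide norm_mult using D_ge[OF that] \<beta>\<omega> assms \<omega>1
        by (intro frac_le mult_mono mult_nonneg_nonneg) (auto simp: norm_power)
      also have "\<dots> = M / \<omega>^3"
        using \<omega>1 pos by (simp add: M_def eval_nat_numeral field_simps)
      finally show ?thesis .
    qed
    have "M / \<omega>^3 \<le> 1"
      using \<omega>M \<omega>1 self_le_power[OF \<omega>1, of 3] by (simp add: divide_simps)
    then have "F \<in> cball 0 1 \<rightarrow> cball 0 1"
      using F_le by (fastforce simp: dist_norm)
    moreover have "continuous_on (cball 0 1) F"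
      unfolding F_def using D_nz
      by (intro continuous_intros) (auto simp: D_def wave_denom_def dist_norm intro!: continuous_intros)
    ultimately obtain z where z: "cmod z \<le> 1" "F z = z"
      using brouwer_ball[of 1 0 F] by (auto simp: dist_norm)
    have "z * D z = of_real (\<alpha>\<^sup>2) * (1 + of_real \<tau> * (w + z))"
      using z(2) D_nz[OF z(1)] unfolding F_def by (simp add: field_simps)
    then have "char_P \<tau> b \<alpha> (\<omega>\<^sup>2) (w + z) = 0"
      using char_P_wave_denom[OF w(1)] by (simp add: D_def)
    moreover have "cmod (z - F 0) \<le> N / \<omega>^5"
    proof -
      \<comment> \<open>Numerator and denominator are varied separately; each part has order
        \<omega>^(-7), the first since \<open>z\<close> is O(\<omega>^(-3)), the second since
        \<open>D z - D 0\<close> is then bounded.\<close>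
      have eq: "F z - F 0 = of_real (\<alpha>\<^sup>2) *
          (of_real \<tau> * z / D z - (1 + of_real \<tau> * w) * (D z - D 0) / (D z * D 0))"
        using D_nz[OF z(1)] D_nz[of 0] unfolding F_def by (simp add: field_simps)
      have z_le: "cmod z \<le> M / \<omega>^3"
        using F_le[OF z(1)] z(2) by simp
      have 1: "cmod (of_real \<tau> * z / D z) \<le> \<tau> * (M / \<omega>^3) / (\<beta> * \<omega>^4)"
        unfolding norm_divide norm_mult using z_le D_ge[OF z(1)] \<beta>\<omega> assms pos \<omega>1
        by (intro frac_le mult_mono mult_nonneg_nonneg) auto
      have "cmod (1 + of_real \<tau> * w) \<le> 1 + \<tau> * \<omega>"
        using w assms by (intro norm_triangle_le) (simp add: norm_mult)
      also have "\<dots> \<le> (1 + \<tau>) * \<omega>"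
        using \<omega>1 by (simp add: algebra_simps)
      finally have w_le: "cmod (1 + of_real \<tau> * w) \<le> (1 + \<tau>) * \<omega>" .
      have "cmod (D z - D 0) \<le> L * \<omega>^3 * (M / \<omega>^3)"
        using D_diff[OF z(1)] mult_left_mono[OF z_le, of "L * \<omega>^3"] pos \<omega>1
        by (meson less_eq_real_def mult_nonneg_nonneg order_trans zero_le_one zero_le_power)
      then have "cmod ((1 + of_real \<tau> * w) * (D z - D 0) / (D z * D 0))
          \<le> ((1 + \<tau>) * \<omega> * (L * \<omega>^3 * (M / \<omega>^3))) / (\<beta> * \<omega>^4 * (2 * \<beta> * \<omega>^4))"
        unfolding norm_divide norm_mult using w_le D_ge[OF z(1)] \<beta>\<omega> assms pos \<omega>1
        by (intro frac_le mult_mono mult_nonneg_nonneg mult_pos_pos)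
           (auto simp: D0 norm_mult norm_power)
      with 1 have "cmod (F z - F 0) \<le> \<alpha>\<^sup>2 * (\<tau> * (M / \<omega>^3) / (\<beta> * \<omega>^4) +
          ((1 + \<tau>) * \<omega> * (L * \<omega>^3 * (M / \<omega>^3))) / (\<beta> * \<omega>^4 * (2 * \<beta> * \<omega>^4)))"
        unfolding eq norm_mult
        by (intro mult_mono norm_triangle_le_diff) (auto simp: norm_power)
      also have "\<dots> = N / \<omega>^7"
        using pos \<omega>1 by (simp add: N_def eval_nat_numeral field_simps)
      \<comment> \<open>The order \<omega>^(-7) obtained is weakened to \<omega>^(-5), which is the
        claimed O(\<lambda>^(-5/2)).\<close>
      also have "\<dots> \<le> N / \<omega>^5"
        using \<omega>1 \<open>0 \<le> N\<close> by (intro divide_left_mono power_increasing) auto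
      finally show ?thesis
        using z(2) by simp
    qed
    moreover have "(w + z) - (w - of_real (\<alpha>\<^sup>2) * (1 + of_real \<tau> * w) / of_real (2 * \<beta> * \<omega>^4)) = z - F 0"
      unfolding F_def D0 by (simp add: algebra_simps)
    ultimately show ?thesis
      by metis
  qed
  show thesis
    by (rule that[of "max 1 (max M (L / \<beta>))" N]) (use root in \<open>auto simp: \<beta>_def\<close>)
qed

section \<open>The expansion along the sequence of eigenvalues\<close>

lemma wave_branch:
  fixes lam :: "nat \<Rightarrow> real"
  assumes "0 < \<tau>" "\<tau> < b" and lim: "filterlim lam at_top sequentially" and \<sigma>: "\<sigma> \<in> {1, -1::real}"
  obtains s where "\<forall>\<^sub>F k in sequentially. char_P \<tau> b \<alpha> (lam k) (s k) = 0"
    and "(\<lambda>k. s k - (of_real \<sigma> * \<i> * of_real (sqrt (lam k))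
                  - of_real (\<alpha>\<^sup>2 / (2 * (b - \<tau>) * (lam k)\<^sup>2))
                  - of_real \<sigma> * \<i> * of_real (\<alpha>\<^sup>2 * \<tau> / (2 * (b - \<tau>) * lam k powr (3/2)))))
        \<in> O(\<lambda>k. of_real (lam k powr (-5/2)))"
proof -
  obtain N \<omega>0 :: real where "0 < \<omega>0" and root: "\<And>\<omega> w. \<omega>0 \<le> \<omega> \<Longrightarrow> w\<^sup>2 = - of_real (\<omega>\<^sup>2) \<Longrightarrow> cmod w = \<omega> \<Longrightarrow>
      \<exists>s. char_P \<tau> b \<alpha> (\<omega>\<^sup>2) s = 0 \<and>
        cmod (s - (w - of_real (\<alpha>\<^sup>2) * (1 + of_real \<tau> * w) / of_real (2 * (b - \<tau>) * \<omega>^4))) \<le> N / \<omega>^5"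
    using wave_root_near[OF assms(1,2)] by metis
  define A where "A k = of_real \<sigma> * \<i> * of_real (sqrt (lam k))
                  - of_real (\<alpha>\<^sup>2 / (2 * (b - \<tau>) * (lam k)\<^sup>2))
                  - of_real \<sigma> * \<i> * of_real (\<alpha>\<^sup>2 * \<tau> / (2 * (b - \<tau>) * lam k powr (3/2)))" for k
  have "\<exists>s. char_P \<tau> b \<alpha> (lam k) s = 0 \<and> cmod (s - A k) \<le> N * lam k powr (-5/2)"
    if "\<omega>0\<^sup>2 \<le> lam k" for k
  proof -
    define \<omega> where "\<omega> = sqrt (lam k)"
    define w where "w = of_real \<sigma> * \<i> * of_real \<omega>"
    have "0 < lam k"
      using that \<open>0 < \<omega>0\<close> zero_less_power[of \<omega>0 2] by linarith
    then have lam: "lam k = \<omega>\<^sup>2" and \<omega>: "\<omega>0 \<le> \<omega>" "0 < \<omega>"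
      using real_le_rsqrt[OF that] by (auto simp: \<omega>_def)
    have powr: "lam k powr a = \<omega> powr (2 * a)" for a
      using \<omega> by (simp add: lam powr_powr flip: powr_numeral)
    have p: "lam k powr (3/2) = \<omega>^3" "lam k powr (-5/2) = 1 / \<omega>^5"
      using \<omega> unfolding powr by (simp_all add: powr_minus_divide powr_numeral)
    have w: "w\<^sup>2 = - of_real (\<omega>\<^sup>2)" "cmod w = \<omega>"
      using \<sigma> \<omega> by (auto simp: w_def power_mult_distrib norm_mult)
    \<comment> \<open>Expanding \<open>1 + of_real \<tau> * w\<close> separates the correction into
      its real term of order \<lambda>^(-2) and its imaginary term of order
      \<lambda>^(-3/2).\<close>
    have "A k = w - of_real (\<alpha>\<^sup>2) * (1 + of_real \<tau> * w) / of_real (2 * (b - \<tau>) * \<omega>^4)"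
    proof -
      have "\<alpha>\<^sup>2 * \<tau> / (2 * (b - \<tau>) * \<omega>^3) = \<alpha>\<^sup>2 * \<tau> * \<omega> / (2 * (b - \<tau>) * \<omega>^4)"
        using \<omega> by (simp add: eval_nat_numeral)
      moreover have "(lam k)\<^sup>2 = \<omega>^4"
        by (simp add: lam)
      ultimately show ?thesis
        unfolding A_def p w_def \<omega>_def[symmetric] by (simp add: add_divide_distrib ring_distribs mult_ac)
    qed
    then show ?thesis
      using root[OF \<omega>(1) w] unfolding p unfolding lam by simp
  qed
  \<comment> \<open>The roots are chosen simultaneously for all \<open>k\<close>; below the
    threshold \<open>s k\<close> is arbitrary, which an eventual statement tolerates.\<close>
  then obtain s where s: "\<And>k. \<omega>0\<^sup>2 \<le> lam k \<Longrightarrow>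
      char_P \<tau> b \<alpha> (lam k) (s k) = 0 \<and> cmod (s k - A k) \<le> N * lam k powr (-5/2)"
    by metis
  have ev: "\<forall>\<^sub>F k in sequentially. \<omega>0\<^sup>2 \<le> lam k"
    using lim by (simp add: filterlim_at_top)
  show thesis
  proof (rule that)
    show "\<forall>\<^sub>F k in sequentially. char_P \<tau> b \<alpha> (lam k) (s k) = 0"
      using ev by eventually_elim (use s in auto)
    have "\<forall>\<^sub>F k in sequentially. norm (s k - A k) \<le> N * norm (of_real (lam k powr (-5/2)) :: complex)"
      using ev by eventually_elim (use s in auto)
    then show "(\<lambda>k. s k - (of_real \<sigma> * \<i> * of_real (sqrt (lam k))
                  - of_real (\<alpha>\<^sup>2 / (2 * (b - \<tau>) * (lam k)\<^sup>2))
                  - of_real \<sigma> * \<i> * of_real (\<alpha>\<^sup>2 * \<tau> / (2 * (b - \<tau>) * lam k powr (3/2)))))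
        \<in> O(\<lambda>k. of_real (lam k powr (-5/2)))"
      unfolding A_def by (rule bigoI)
  qed
qed

text \<open>The error is of smaller order than the \<lambda>^(-2) term. Asymptotic equivalence then
  hands the sign, the limit and the exact order of that term over to the real parts.\<close>

lemma asymp_equiv_inverse_square:
  fixes lam r :: "nat \<Rightarrow> real"
  assumes lim: "filterlim lam at_top sequentially" and "c \<noteq> 0"
    and r: "(\<lambda>k. r k - c / (lam k)\<^sup>2) \<in> O(\<lambda>k. lam k powr (-5/2))"
  shows "r \<sim>[sequentially] (\<lambda>k. c / (lam k)\<^sup>2)"
proof (rule smallo_imp_asymp_equiv)
  have "(\<lambda>x::real. x powr (-5/2)) \<in> o(\<lambda>x. c / x\<^sup>2)"
    using \<open>c \<noteq> 0\<close> by real_asymp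
  then have "(\<lambda>k. lam k powr (-5/2)) \<in> o(\<lambda>k. c / (lam k)\<^sup>2)"
    by (rule landau_o.small.compose[OF _ lim])
  with r show "(\<lambda>k. r k - c / (lam k)\<^sup>2) \<in> o(\<lambda>k. c / (lam k)\<^sup>2)"
    by (rule landau_o.big_small_trans)
qed

section \<open>Real parts of the branches and absence of a spectral gap\<close>

theorem proposition2p2:
  fixes \<Omega> :: "(real^'n) set"
    and lam :: "nat \<Rightarrow> real"
    and e :: "nat \<Rightarrow> real^'n \<Rightarrow> real"
    and b \<tau> \<alpha> c_w c_mgt :: real
  assumes dim: "CARD('n) \<ge> 3"
    and domain: "smooth_bounded_domain \<Omega>"
    and eigenbasis: "dirichlet_eigenbasis \<Omega> lam e"
    and lam_pos: "0 < lam 1"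
    and lam_mono: "\<And>j k. 1 \<le> j \<Longrightarrow> j \<le> k \<Longrightarrow> lam j \<le> lam k"
    and lam_lim: "filterlim lam at_top sequentially"
    and params: "b > \<tau>" "\<tau> > 0" "\<alpha> \<noteq> 0"
    and speeds: "c_w = 1" "c_mgt = sqrt (b / \<tau>)"
  shows "(\<forall>\<sigma>\<in>{1, -1::real}. \<exists>s :: nat \<Rightarrow> complex.
      (\<forall>\<^sub>F k in sequentially. char_P \<tau> b \<alpha> (lam k) (s k) = 0) \<and>
      (\<lambda>k. s k - (of_real \<sigma> * \<i> * of_real (sqrt (lam k))
                  - of_real (\<alpha>\<^sup>2 / (2 * (b - \<tau>) * (lam k)\<^sup>2))
                  - of_real \<sigma> * \<i> * of_real (\<alpha>\<^sup>2 * \<tau> / (2 * (b - \<tau>) * lam k powr (3/2)))))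
        \<in> O(\<lambda>k. of_real (lam k powr (-5/2))) \<and>
      (\<lambda>k. Re (s k) - (- \<alpha>\<^sup>2 / (2 * (b - \<tau>) * (lam k)\<^sup>2))) \<in> O(\<lambda>k. lam k powr (-5/2)) \<and>
      filterlim (\<lambda>k. Re (s k)) (at_left 0) sequentially \<and>
      (\<lambda>k. Re (s k) - (- \<alpha>\<^sup>2 / (2 * \<tau> * (c_mgt\<^sup>2 - c_w\<^sup>2) * (lam k)\<^sup>2)))
        \<in> O(\<lambda>k. lam k powr (-5/2)) \<and>
      (\<lambda>k. Re (s k)) \<in> \<Theta>(\<lambda>k. 1 / (lam k)\<^sup>2)) \<and>
    \<not> (\<exists>\<delta>>0. \<forall>s \<in> linearized_spectrum \<tau> b \<alpha> lam. \<bar>Re s\<bar> \<ge> \<delta>)"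
proof -
  define c where "c = - \<alpha>\<^sup>2 / (2 * (b - \<tau>))"
  have "c < 0"
    using params by (simp add: c_def divide_neg_pos)
  \<comment> \<open>Since \<tau> (b/\<tau> - 1) = b - \<tau>, the form with the two speeds has the
    same leading coefficient.\<close>
  have coeff: "2 * \<tau> * (c_mgt\<^sup>2 - c_w\<^sup>2) = 2 * (b - \<tau>)"
    using params by (simp add: speeds field_simps)
  have c_lam: "- \<alpha>\<^sup>2 / (2 * (b - \<tau>) * (lam k)\<^sup>2) = c / (lam k)\<^sup>2" for k
    by (simp add: c_def)
  \<comment> \<open>Of the three explicit terms only the \<lambda>^(-2) one is real, the others
    being purely imaginary, and passing to real parts does not enlarge the error. So the complex
    expansion alone yields everything claimed about the real parts.\<close>
  have Re_props: "(\<lambda>k. Re (s k) - c / (lam k)\<^sup>2) \<in> O(\<lambda>k. lam k powr (-5/2)) \<and>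
      filterlim (\<lambda>k. Re (s k)) (at_left 0) sequentially \<and> (\<lambda>k. Re (s k)) \<in> \<Theta>(\<lambda>k. 1 / (lam k)\<^sup>2)"
    if s: "(\<lambda>k. s k - (of_real \<sigma> * \<i> * of_real (sqrt (lam k))
                  - of_real (\<alpha>\<^sup>2 / (2 * (b - \<tau>) * (lam k)\<^sup>2))
                  - of_real \<sigma> * \<i> * of_real (\<alpha>\<^sup>2 * \<tau> / (2 * (b - \<tau>) * lam k powr (3/2)))))
        \<in> O(\<lambda>k. of_real (lam k powr (-5/2)))" (is "?E \<in> _") for s \<sigma>
  proof -
    obtain C where C: "\<forall>\<^sub>F k in sequentially. cmod (?E k) \<le> C * norm (of_real (lam k powr (-5/2)) :: complex)"
      by (rule landau_o.bigE[OF s])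
    have "Re (s k) - c / (lam k)\<^sup>2 = Re (?E k)" for k
      by (simp add: c_def)
    then have le: "norm (Re (s k) - c / (lam k)\<^sup>2) \<le> cmod (?E k)" for k
      using abs_Re_le_cmod[of "?E k"] by (simp only: real_norm_def)
    from C have "\<forall>\<^sub>F k in sequentially. norm (Re (s k) - c / (lam k)\<^sup>2) \<le> C * norm (lam k powr (-5/2))"
      unfolding norm_of_real real_norm_def[symmetric] by eventually_elim (rule order_trans[OF le])
    then have Re: "(\<lambda>k. Re (s k) - c / (lam k)\<^sup>2) \<in> O(\<lambda>k. lam k powr (-5/2))"
      by (rule bigoI)
    then have equiv: "(\<lambda>k. Re (s k)) \<sim>[sequentially] (\<lambda>k. c / (lam k)\<^sup>2)"
      using \<open>c < 0\<close> by (intro asymp_equiv_inverse_square[OF lam_lim]) auto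
    have "((\<lambda>x::real. c / x\<^sup>2) \<longlongrightarrow> 0) at_top"
      by real_asymp
    from filterlim_compose[OF this lam_lim] have "(\<lambda>k. Re (s k)) \<longlonglongrightarrow> 0"
      using tendsto_asymp_equiv_cong[OF equiv] by simp
    moreover have "\<forall>\<^sub>F k in sequentially. 0 < lam k"
      using lam_lim by (simp add: filterlim_at_top_dense)
    then have "\<forall>\<^sub>F k in sequentially. Re (s k) < 0"
      using asymp_equiv_eventually_neg_iff[OF equiv]
      by eventually_elim (use \<open>c < 0\<close> in \<open>auto simp: divide_neg_pos\<close>)
    ultimately have "filterlim (\<lambda>k. Re (s k)) (at_left 0) sequentially"
      by (auto simp: filterlim_at elim: eventually_mono)
    moreover have "(\<lambda>k. c / (lam k)\<^sup>2) \<in> \<Theta>(\<lambda>k. 1 / (lam k)\<^sup>2)"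
      using landau_theta.cmult_in_iff[where c = c and f = "\<lambda>k. 1 / (lam k)\<^sup>2"] \<open>c < 0\<close> by simp
    then have "(\<lambda>k. Re (s k)) \<in> \<Theta>(\<lambda>k. 1 / (lam k)\<^sup>2)"
      by (rule landau_theta.trans[OF asymp_equiv_imp_bigtheta[OF equiv]])
    ultimately show ?thesis
      using Re by (intro conjI)
  qed
  have "\<not> (\<exists>\<delta>>0. \<forall>s \<in> linearized_spectrum \<tau> b \<alpha> lam. \<bar>Re s\<bar> \<ge> \<delta>)"
  proof
    assume "\<exists>\<delta>>0. \<forall>s \<in> linearized_spectrum \<tau> b \<alpha> lam. \<bar>Re s\<bar> \<ge> \<delta>"
    then obtain \<delta> where \<delta>: "0 < \<delta>" "\<And>s. s \<in> linearized_spectrum \<tau> b \<alpha> lam \<Longrightarrow> \<bar>Re s\<bar> \<ge> \<delta>"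
      by blast
    \<comment> \<open>One branch suffices: the roots with sign +1 already have real parts tending to
      0.\<close>
    obtain s where root: "\<forall>\<^sub>F k in sequentially. char_P \<tau> b \<alpha> (lam k) (s k) = 0"
      and "filterlim (\<lambda>k. Re (s k)) (at_left 0) sequentially"
    proof (rule wave_branch[OF params(2,1) lam_lim, of 1 \<alpha>])
      fix s
      assume 1: "\<forall>\<^sub>F k in sequentially. char_P \<tau> b \<alpha> (lam k) (s k) = 0"
        and 2: "(\<lambda>k. s k - (of_real 1 * \<i> * of_real (sqrt (lam k))
                  - of_real (\<alpha>\<^sup>2 / (2 * (b - \<tau>) * (lam k)\<^sup>2))
                  - of_real 1 * \<i> * of_real (\<alpha>\<^sup>2 * \<tau> / (2 * (b - \<tau>) * lam k powr (3/2)))))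
        \<in> O(\<lambda>k. of_real (lam k powr (-5/2)))"
      show thesis
        by (rule that[OF 1 Re_props[OF 2, THEN conjunct2, THEN conjunct1]])
    qed simp
    then have lim: "(\<lambda>k. Re (s k)) \<longlonglongrightarrow> 0"
      by (simp add: filterlim_at)
    have "\<forall>\<^sub>F k in sequentially. \<bar>Re (s k)\<bar> < \<delta>"
      using tendstoD[OF lim \<delta>(1)] by simp
    \<comment> \<open>The restriction to \<open>k\<close> at least 1 is there because the spectrum
      is indexed from 1.\<close>
    with root eventually_ge_at_top[of 1] have "\<forall>\<^sub>F k in sequentially. False"
    proof eventually_elim
      case (elim k)
      then have "s k \<in> linearized_spectrum \<tau> b \<alpha> lam"
        by (auto simp: linearized_spectrum_def)
      with elim \<delta>(2) show ?case
        by fastforce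
    qed
    then show False
      by simp
  qed
  then show ?thesis
    unfolding coeff c_lam
  proof (intro conjI ballI, goal_cases)
    case (1 \<sigma>)
    obtain s where s: "\<forall>\<^sub>F k in sequentially. char_P \<tau> b \<alpha> (lam k) (s k) = 0"
      "(\<lambda>k. s k - (of_real \<sigma> * \<i> * of_real (sqrt (lam k))
                  - of_real (\<alpha>\<^sup>2 / (2 * (b - \<tau>) * (lam k)\<^sup>2))
                  - of_real \<sigma> * \<i> * of_real (\<alpha>\<^sup>2 * \<tau> / (2 * (b - \<tau>) * lam k powr (3/2)))))
        \<in> O(\<lambda>k. of_real (lam k powr (-5/2)))"
      by (rule wave_branch[OF params(2,1) lam_lim 1(2)])
    show ?case
      using s Re_props[OF s(2)] by (intro exI[of _ s] conjI) (elim conjE, assumption)+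
  qed
qed

end
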